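(* Let $q$ be a prime power and let $r\geq 2$ be an integer. Let $\mathbb{F}=\mathrm{GF}(q^{r-1})$ and let $H\subseteq\mathbb{F}^\ast$ be the subgroup of the multiplicative group of order $q^{r-2}+\cdots+q+1$. Let $G(q^{r-1},q^{r-2}+\cdots+q+1)$ be the graph whose vertex set is $(\mathbb{F}\times\mathbb{F}\setminus\{(0,0)\})/\sim$, where $(a_1,b_1)\sim(a_2,b_2)$ iff there is $h\in H$ with $a_1=ha_2$ and $b_1=hb_2$, and in which two distinct vertices $\langle a,b\rangle$ and $\langle x,y\rangle$ are adjacent iff $ax+by\in H$. Then this graph is $K_{r,(r-1)!+1}$-free.
   Context: $\langle a,b\rangle$ denotes the equivalence class of $(a,b)$; adjacency is independent of representatives; the graph is simple (no loops). A graph is $K_{s,u}$-free if it contains no (not necessarily induced) subgraph isomorphic to the complete bipartite graph $K_{s,u}$. *)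

theory Defs
  imports "HOL-Computational_Algebra.Primes"
begin

definition prime_power :: "nat \<Rightarrow> bool" where
  "prime_power q \<longleftrightarrow> (\<exists>p k. prime p \<and> k \<ge> 1 \<and> q = p ^ k)"

definition mult_subgroup :: "'a::field set \<Rightarrow> bool" where
  "mult_subgroup H \<longleftrightarrow> H \<subseteq> UNIV - {0} \<and> 1 \<in> H \<and>
     (\<forall>x\<in>H. \<forall>y\<in>H. x * y \<in> H) \<and> (\<forall>x\<in>H. inverse x \<in> H)"

definition scal_rel :: "'a::field set \<Rightarrow> (('a \<times> 'a) \<times> ('a \<times> 'a)) set" where
  "scal_rel H = {((a1, b1), (a2, b2)). (a1, b1) \<noteq> (0, 0) \<and> (a2, b2) \<noteq> (0, 0) \<and>
      (\<exists>h\<in>H. a1 = h * a2 \<and> b1 = h * b2)}"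

definition G_vertices :: "'a::field set \<Rightarrow> ('a \<times> 'a) set set" where
  "G_vertices H = (UNIV - {(0, 0)}) // scal_rel H"

text \<open>Adjacency: distinct classes <a,b>, <x,y> with a x + b y in H
  (independent of representatives).\<close>
definition G_adj :: "'a::field set \<Rightarrow> ('a \<times> 'a) set \<Rightarrow> ('a \<times> 'a) set \<Rightarrow> bool" where
  "G_adj H X Y \<longleftrightarrow> X \<noteq> Y \<and> (\<exists>(a, b)\<in>X. \<exists>(x, y)\<in>Y. a * x + b * y \<in> H)"

definition Ksu_free :: "'v set \<Rightarrow> ('v \<Rightarrow> 'v \<Rightarrow> bool) \<Rightarrow> nat \<Rightarrow> nat \<Rightarrow> bool" where
  "Ksu_free V E s u \<longleftrightarrow> \<not> (\<exists>S T. S \<subseteq> V \<and> T \<subseteq> V \<and> S \<inter> T = {} \<and>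
       finite S \<and> finite T \<and> card S = s \<and> card T = u \<and> (\<forall>x\<in>S. \<forall>y\<in>T. E x y))"

end

theory Submission
  imports Defs "HOL-Library.Function_Algebras" "HOL-Computational_Algebra.Polynomial"
begin

text \<open>
  \<open>H\<close> is the kernel of the norm \<open>N z = z ^ (1 + q + \<dots> + q ^ (r - 2))\<close>. Vertices with a common
  neighbour are pairwise linearly independent, so after a linear change of coordinates the common
  neighbours of \<open>r\<close> vertices correspond to the solutions \<open>z\<close> of \<open>r - 1\<close> equations
  \<open>N (z - e\<^sub>i) = b\<^sub>i\<close> with distinct \<open>e\<^sub>i\<close>. Since the Frobenius map is additive, with
  \<open>t = z\<close>, \<open>x\<^sub>k = z ^ q ^ (k + 1)\<close> and \<open>n = r - 2\<close> these equations read
  \<open>(t - c\<^sub>i) h\<^sub>i = b\<^sub>i\<close>, where \<open>h\<^sub>i = \<Prod>k<n. (x\<^sub>k - a\<^sub>i\<^sub>k)\<close> and the \<open>a\<^sub>i\<^sub>k\<close> are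
  distinct for each \<open>k\<close>.

  To bound the number of solutions by \<open>(n + 1)!\<close>, consider the space \<open>R\<close> of functions on the
  solution set spanned by the \<open>(n + 1)!\<close> monomials \<open>\<Prod>k<n. x\<^sub>k ^ d\<^sub>k\<close> with \<open>d\<^sub>k \<le> k + 1\<close>, and let
  \<open>P\<close> be spanned by those with \<open>d\<^sub>k \<le> k\<close>. Interpolation in one variable at a time shows
  \<open>R = (\<Sum>i. h\<^sub>i P)\<close>. As \<open>t h\<^sub>i = b\<^sub>i + c\<^sub>i h\<^sub>i\<close>, the space \<open>R\<close> is closed under multiplication
  by \<open>t\<close>; it contains \<open>1\<close>, hence all polynomials in \<open>t\<close>, hence all functions on the solution set,
  because \<open>t\<close> separates points.
\<close>

section \<open>Linear algebra in spaces of functions\<close>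

interpretation fun_vs: vector_space "\<lambda>(c::'a::field) (f::'s \<Rightarrow> 'a) s. c * f s"
  by unfold_locales (auto simp: fun_eq_iff algebra_simps)

lemma sum_fun_apply: "(\<Sum>i\<in>A. f i) s = (\<Sum>i\<in>A. f i s)"
  for f :: "'i \<Rightarrow> 's \<Rightarrow> 'a::comm_monoid_add"
  by (induction A rule: infinite_finite_induct) auto

text \<open>Together with \<open>span_minimal\<close>, this reduces showing that multiplication by
  \<open>g\<close> maps a span into \<open>W\<close> to checking generators.\<close>

lemma subspace_mult_preimage:
  assumes "fun_vs.subspace W"
  shows "fun_vs.subspace {f. (\<lambda>s. g s * f s) \<in> W}"
proof (rule fun_vs.subspaceI)
  show "0 \<in> {f. (\<lambda>s. g s * f s) \<in> W}"
    using fun_vs.subspace_0[OF assms] by (simp add: zero_fun_def)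
next
  fix f f' assume "f \<in> {f. (\<lambda>s. g s * f s) \<in> W}" "f' \<in> {f. (\<lambda>s. g s * f s) \<in> W}"
  then show "f + f' \<in> {f. (\<lambda>s. g s * f s) \<in> W}"
    using fun_vs.subspace_add[OF assms, of "\<lambda>s. g s * f s" "\<lambda>s. g s * f' s"]
    by (simp add: plus_fun_def distrib_left)
next
  fix c f assume "f \<in> {f. (\<lambda>s. g s * f s) \<in> W}"
  then show "(\<lambda>s. c * f s) \<in> {f. (\<lambda>s. g s * f s) \<in> W}"
    using fun_vs.subspace_scale[OF assms, of "\<lambda>s. g s * f s" c]
    by (simp add: mult.left_commute)
qed

lemma poly_comp_in_subspace:
  fixes t :: "'s \<Rightarrow> 'a::field"
  assumes "fun_vs.subspace W" and "\<And>k. k \<le> degree p \<Longrightarrow> (\<lambda>s. f s * t s ^ k) \<in> W"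
  shows "(\<lambda>s. f s * poly p (t s)) \<in> W"
proof -
  have "(\<lambda>s. f s * poly p (t s)) = (\<Sum>k\<le>degree p. (\<lambda>s. coeff p k * (f s * t s ^ k)))"
    by (simp add: fun_eq_iff sum_fun_apply poly_altdef sum_distrib_left mult.left_commute)
  also have "\<dots> \<in> W"
    using assms by (intro fun_vs.subspace_sum fun_vs.subspace_scale) auto
  finally show ?thesis .
qed

section \<open>Interpolation and staircase monomials\<close>

lemma lagrange_interpolation:
  fixes p :: "'a::field poly"
  assumes "finite I" and "inj_on a I" and "degree p < card I"
  shows "p = (\<Sum>j\<in>I. smult (poly p (a j) / (\<Prod>i\<in>I - {j}. a j - a i)) (\<Prod>i\<in>I - {j}. [:- a i, 1:]))"
    (is "p = ?q")
proof (rule poly_eqI_degree)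
  have card: "card (a ` I) = card I" using assms by (simp add: card_image)
  show "degree p < card (a ` I)" using assms card by simp
  have "degree ?q \<le> card I - 1"
  proof (rule degree_sum_le[OF assms(1)])
    fix j assume "j \<in> I"
    have "degree (\<Prod>i\<in>I - {j}. [:- a i, 1:]) \<le> (\<Sum>i\<in>I - {j}. degree [:- a i, 1:])"
      by (rule order_trans[OF degree_prod_sum_le]) (use assms in auto)
    also have "\<dots> = card I - 1" using \<open>j \<in> I\<close> assms by simp
    finally show "degree (smult (poly p (a j) / (\<Prod>i\<in>I - {j}. a j - a i)) (\<Prod>i\<in>I - {j}. [:- a i, 1:]))
        \<le> card I - 1"
      using degree_smult_le order_trans by blast
  qed
  then show "degree ?q < card (a ` I)" using assms card by linarith
  fix y assume "y \<in> a ` I"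
  then obtain k where k: "k \<in> I" "y = a k" by auto
  have "poly ?q y = (\<Sum>j\<in>I. if j = k then poly p (a j) else 0)"
    unfolding poly_sum
  proof (rule sum.cong[OF refl])
    fix j assume j: "j \<in> I"
    show "poly (smult (poly p (a j) / (\<Prod>i\<in>I - {j}. a j - a i)) (\<Prod>i\<in>I - {j}. [:- a i, 1:])) y
        = (if j = k then poly p (a j) else 0)"
    proof (cases "j = k")
      case True
      have "(\<Prod>i\<in>I - {k}. a k - a i) \<noteq> 0"
        using assms k by (auto simp: inj_on_def)
      then show ?thesis using True k by (simp add: poly_prod)
    next
      case False
      then have "(\<Prod>i\<in>I - {j}. y - a i) = 0"
        using assms k by (intro prod_zero) auto
      then show ?thesis using False by (simp add: poly_prod)
    qed
  qed
  also have "\<dots> = poly p y" using k assms by simp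
  finally show "poly p y = poly ?q y" by simp
qed

text \<open>The exponent of \<open>x k\<close> runs up to \<open>k + d\<close>, so
  \<open>d = 1\<close> yields the generators of \<open>R\<close> and \<open>d = 0\<close> those of
  \<open>P\<close>.\<close>

primrec stair_monomials :: "(nat \<Rightarrow> 's \<Rightarrow> 'a::field) \<Rightarrow> nat \<Rightarrow> nat \<Rightarrow> ('s \<Rightarrow> 'a) set" where
  "stair_monomials x d 0 = {\<lambda>_. 1}"
| "stair_monomials x d (Suc n) =
    (\<lambda>(f, e) s. f s * x n s ^ e) ` (stair_monomials x d n \<times> {..n + d})"

lemma finite_stair_monomials: "finite (stair_monomials x d n)"
  by (induction n) auto

lemma one_in_stair_monomials: "(\<lambda>_. 1) \<in> stair_monomials x d n"
proof (induction n)
  case (Suc n)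
  then have "(\<lambda>s. 1 * x n s ^ 0) \<in> stair_monomials x d (Suc n)"
    unfolding stair_monomials.simps by (intro image_eqI[of _ _ "(\<lambda>_. 1, 0)"]) auto
  then show ?case by simp
qed simp

lemma stair_monomials_mono: "d \<le> d' \<Longrightarrow> stair_monomials x d n \<subseteq> stair_monomials x d' n"
  by (induction n) (auto 0 3 simp: image_iff subset_iff)

lemma card_stair_monomials_1: "card (stair_monomials x 1 n) \<le> fact (Suc n)"
proof (induction n)
  case (Suc n)
  have "card (stair_monomials x 1 (Suc n)) \<le> card (stair_monomials x 1 n \<times> {..n + 1})"
    unfolding stair_monomials.simps by (rule card_image_le) (simp add: finite_stair_monomials)
  also have "\<dots> \<le> fact (Suc n) * (n + 2)"
    unfolding card_cartesian_product using Suc by (intro mult_mono) auto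
  finally show ?case by (simp add: algebra_simps)
qed auto

text \<open>Each factor \<open>x k s - a k\<close> raises the exponent of its own variable by at
  most one, from the bound \<open>k\<close> to \<open>k + 1\<close>.\<close>

lemma mult_prod_in_span_stair_monomials:
  fixes x :: "nat \<Rightarrow> 's \<Rightarrow> 'a::field"
  assumes "f \<in> stair_monomials x 0 n"
  shows "(\<lambda>s. f s * (\<Prod>k<n. x k s - a k)) \<in> fun_vs.span (stair_monomials x 1 n)"
  using assms
proof (induction n arbitrary: f)
  case 0
  then show ?case by (auto intro: fun_vs.span_base)
next
  case (Suc n)
  then obtain g e where g: "g \<in> stair_monomials x 0 n" "e \<le> n" "f = (\<lambda>s. g s * x n s ^ e)"
    by auto
  let ?W = "fun_vs.span (stair_monomials x 1 (Suc n))"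
  let ?p = "monom 1 e * [:- a n, 1:]"
  have deg: "degree ?p \<le> Suc n"
    using degree_mult_le[of "monom 1 e" "[:- a n, 1:]"] g(2) degree_monom_le[of 1 e]
    by (simp add: degree_monom_eq)
  have "(\<lambda>s. poly ?p (x n s) * (g s * (\<Prod>k<n. x k s - a k))) \<in> ?W"
  proof -
    have "fun_vs.span (stair_monomials x 1 n) \<subseteq> {h. (\<lambda>s. poly ?p (x n s) * h s) \<in> ?W}"
    proof (rule fun_vs.span_minimal)
      show "stair_monomials x 1 n \<subseteq> {h. (\<lambda>s. poly ?p (x n s) * h s) \<in> ?W}"
      proof safe
        fix h assume h: "h \<in> stair_monomials x 1 n"
        have "(\<lambda>s. h s * poly ?p (x n s)) \<in> ?W"
        proof (rule poly_comp_in_subspace)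
          fix k assume "k \<le> degree ?p"
          then have "(h, k) \<in> stair_monomials x 1 n \<times> {..n + 1}" using deg h by auto
          then show "(\<lambda>s. h s * x n s ^ k) \<in> ?W"
            by (intro fun_vs.span_base) (force simp: image_iff)
        qed auto
        then show "(\<lambda>s. poly ?p (x n s) * h s) \<in> ?W" by (simp add: mult.commute)
      qed
    qed (intro subspace_mult_preimage fun_vs.subspace_span)
    then show ?thesis using Suc.IH[OF g(1)] by auto
  qed
  moreover have "(\<lambda>s. poly ?p (x n s) * (g s * (\<Prod>k<n. x k s - a k))) =
      (\<lambda>s. f s * (\<Prod>k<Suc n. x k s - a k))"
    by (simp add: fun_eq_iff g(3) poly_monom algebra_simps)
  ultimately show ?case by simp
qed

text \<open>Induction on the number of variables: interpolation in the last variable writes its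
  power through products that omit one index \<open>j\<close>, and the remaining monomial is
  expanded by the induction hypothesis for \<open>I - {j}\<close>.\<close>

lemma stair_monomials_1_subset_span:
  fixes x :: "nat \<Rightarrow> 's \<Rightarrow> 'a::field" and a :: "'i \<Rightarrow> nat \<Rightarrow> 'a"
  assumes "finite I" and "card I = Suc n" and "\<And>k. k < n \<Longrightarrow> inj_on (\<lambda>i. a i k) I"
  shows "stair_monomials x 1 n \<subseteq> fun_vs.span
    (\<Union>i\<in>I. (\<lambda>f s. (\<Prod>k<n. x k s - a i k) * f s) ` stair_monomials x 0 n)"
  using assms
proof (induction n arbitrary: I)
  case 0
  then obtain i where "I = {i}" by (auto simp: card_Suc_eq)
  then show ?case by (auto intro: fun_vs.span_base)
next
  case (Suc n)
  let ?T = "\<lambda>I n. \<Union>i\<in>I. (\<lambda>f s. (\<Prod>k<n. x k s - a i k) * f s) ` stair_monomials x 0 n"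
  let ?W = "fun_vs.span (?T I (Suc n))"
  have key: "(\<lambda>s. (\<Prod>i\<in>I - {j}. x n s - a i n) * f s) \<in> ?W"
    if j: "j \<in> I" and f: "f \<in> stair_monomials x 1 n" for j f
  proof -
    have "fun_vs.span (?T (I - {j}) n) \<subseteq> {h. (\<lambda>s. (\<Prod>i\<in>I - {j}. x n s - a i n) * h s) \<in> ?W}"
    proof (rule fun_vs.span_minimal)
      show "?T (I - {j}) n \<subseteq> {h. (\<lambda>s. (\<Prod>i\<in>I - {j}. x n s - a i n) * h s) \<in> ?W}"
      proof safe
        fix i f assume i: "i \<in> I" "i \<noteq> j" and f: "f \<in> stair_monomials x 0 n"
        \<comment> \<open>The factor with index \<open>i\<close> completes the product over
          \<open>k < n\<close> to one over \<open>k < Suc n\<close>. The other \<open>n\<close>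
          factors form \<open>?p\<close>, whose degree just meets the exponent bound
          \<open>n\<close> of \<open>x n\<close> for \<open>d = 0\<close>.\<close>
        let ?p = "\<Prod>l\<in>I - {j} - {i}. [:- a l n, 1:]"
        let ?h = "\<lambda>s. (\<Prod>k<Suc n. x k s - a i k) * f s"
        have "degree ?p \<le> (\<Sum>l\<in>I - {j} - {i}. degree [:- a l n, 1:])"
          by (rule order_trans[OF degree_prod_sum_le]) (use Suc.prems in auto)
        also have "\<dots> = n" using i j Suc.prems by (simp add: card_Diff_singleton)
        finally have deg: "degree ?p \<le> n" .
        have "(\<lambda>s. ?h s * poly ?p (x n s)) \<in> ?W"
        proof (rule poly_comp_in_subspace)
          fix e assume "e \<le> degree ?p"
          then have "(f, e) \<in> stair_monomials x 0 n \<times> {..n + 0}" using deg f by auto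
          then have "(\<lambda>s. f s * x n s ^ e) \<in> stair_monomials x 0 (Suc n)"
            by (force simp: image_iff)
          then have "(\<lambda>s. (\<Prod>k<Suc n. x k s - a i k) * (f s * x n s ^ e)) \<in> ?T I (Suc n)"
            by (intro UN_I[OF i(1)] image_eqI[OF refl])
          then show "(\<lambda>s. ?h s * x n s ^ e) \<in> ?W"
            by (simp only: mult.assoc) (rule fun_vs.span_base)
        qed auto
        also have "(\<lambda>s. ?h s * poly ?p (x n s)) =
          (\<lambda>s. (\<Prod>i\<in>I - {j}. x n s - a i n) * ((\<Prod>k<n. x k s - a i k) * f s))"
          using i Suc.prems(1)
          by (simp add: fun_eq_iff poly_prod prod.remove[of "I - {j}" i] mult_ac)
        finally show "(\<lambda>s. (\<Prod>i\<in>I - {j}. x n s - a i n) * ((\<Prod>k<n. x k s - a i k) * f s)) \<in> ?W" .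
      qed
    qed (intro subspace_mult_preimage fun_vs.subspace_span)
    moreover have "f \<in> fun_vs.span (?T (I - {j}) n)"
    proof -
      have "inj_on (\<lambda>i. a i k) (I - {j})" if "k < n" for k
        using Suc.prems(3)[of k] that by (auto intro: inj_on_subset)
      then show ?thesis using Suc.IH[of "I - {j}"] Suc.prems(1,2) j f by auto
    qed
    ultimately show ?thesis by blast
  qed
  show ?case
  proof
    fix g assume "g \<in> stair_monomials x 1 (Suc n)"
    then obtain f e where g: "f \<in> stair_monomials x 1 n" "e \<le> n + 1" "g = (\<lambda>s. f s * x n s ^ e)"
      by auto
    \<comment> \<open>Lagrange coefficients of \<open>y ^ e\<close> at the \<open>n + 2\<close>
      nodes \<open>a j n\<close>; these suffice because \<open>e \<le> n + 1\<close>.\<close>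
    define c where "c j = poly (monom 1 e) (a j n) / (\<Prod>i\<in>I - {j}. a j n - a i n)" for j
    have "monom 1 e = (\<Sum>j\<in>I. smult (c j) (\<Prod>i\<in>I - {j}. [:- a i n, 1:]))"
      unfolding c_def using Suc.prems g(2)
      by (intro lagrange_interpolation) (auto simp: degree_monom_eq)
    then have "poly (monom 1 e) y = poly (\<Sum>j\<in>I. smult (c j) (\<Prod>i\<in>I - {j}. [:- a i n, 1:])) y" for y
      by simp
    then have pow: "y ^ e = (\<Sum>j\<in>I. c j * (\<Prod>i\<in>I - {j}. y - a i n))" for y
      by (simp add: poly_monom poly_sum poly_prod)
    have "g = (\<Sum>j\<in>I. (\<lambda>s. c j * ((\<Prod>i\<in>I - {j}. x n s - a i n) * f s)))"
      by (simp add: fun_eq_iff g(3) pow sum_fun_apply sum_distrib_left mult_ac)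
    also have "\<dots> \<in> ?W"
      by (intro fun_vs.span_sum fun_vs.span_scale key g)
    finally show "g \<in> ?W" .
  qed
qed

section \<open>Counting the solutions of a product system\<close>

theorem card_product_system_le_fact:
  fixes x :: "nat \<Rightarrow> 's \<Rightarrow> 'a::field" and a :: "'i \<Rightarrow> nat \<Rightarrow> 'a"
  assumes "finite S" and "inj_on t S"
    and I: "finite I" "card I = Suc n" "\<And>k. k < n \<Longrightarrow> inj_on (\<lambda>i. a i k) I"
    and eq: "\<And>s i. s \<in> S \<Longrightarrow> i \<in> I \<Longrightarrow> (t s - c i) * (\<Prod>k<n. x k s - a i k) = b i"
  shows "card S \<le> fact (Suc n)"
proof -
  let ?R = "fun_vs.span (stair_monomials x 1 n)"
  \<comment> \<open>The equations hold only on \<open>S\<close>, so closure under \<open>t\<close>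
    can be claimed only up to agreement on \<open>S\<close>.\<close>
  define W where "W = {f. \<exists>g\<in>?R. \<forall>s\<in>S. f s = g s}"
  have W: "fun_vs.subspace W"
  proof (rule fun_vs.subspaceI)
    show "0 \<in> W" unfolding W_def by (auto intro: bexI[OF _ fun_vs.span_zero])
  next
    fix f f' assume "f \<in> W" "f' \<in> W"
    then obtain g g' where "g \<in> ?R" "g' \<in> ?R" "\<forall>s\<in>S. f s = g s" "\<forall>s\<in>S. f' s = g' s"
      unfolding W_def by auto
    then show "f + f' \<in> W"
      unfolding W_def by (auto intro!: bexI[of _ "g + g'"] fun_vs.span_add)
  next
    fix d f assume "f \<in> W"
    then obtain g where "g \<in> ?R" "\<forall>s\<in>S. f s = g s"
      unfolding W_def by auto
    then show "(\<lambda>s. d * f s) \<in> W"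
      unfolding W_def by (auto intro!: bexI[of _ "\<lambda>s. d * g s"] fun_vs.span_scale)
  qed
  have RW: "?R \<subseteq> W" unfolding W_def by auto
  have Wcong: "f \<in> W" if "g \<in> W" "\<And>s. s \<in> S \<Longrightarrow> f s = g s" for f g
    using that unfolding W_def by auto
  have stable_R: "(\<lambda>s. t s * f s) \<in> W" if "f \<in> ?R" for f
  proof -
    let ?T = "\<Union>i\<in>I. (\<lambda>f s. (\<Prod>k<n. x k s - a i k) * f s) ` stair_monomials x 0 n"
    have sub: "fun_vs.subspace {f. (\<lambda>s. t s * f s) \<in> W}"
      by (rule subspace_mult_preimage[OF W])
    have "?T \<subseteq> {f. (\<lambda>s. t s * f s) \<in> W}"
    proof safe
      fix i f assume i: "i \<in> I" and f: "f \<in> stair_monomials x 0 n"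
      let ?h = "\<lambda>s. \<Prod>k<n. x k s - a i k"
      have "f \<in> ?R"
        using f stair_monomials_mono[of 0 1 x n] by (auto intro: fun_vs.span_base)
      moreover have "(\<lambda>s. f s * ?h s) \<in> ?R"
        by (rule mult_prod_in_span_stair_monomials[OF f])
      \<comment> \<open>By the \<open>i\<close>-th equation, this sum agrees on \<open>S\<close>
        with \<open>t\<close> times the generator \<open>?h * f\<close>.\<close>
      ultimately have "(\<lambda>s. b i * f s) + (\<lambda>s. c i * (f s * ?h s)) \<in> ?R"
        by (intro fun_vs.span_add fun_vs.span_scale)
      then have "(\<lambda>s. b i * f s) + (\<lambda>s. c i * (f s * ?h s)) \<in> W" using RW by blast
      then show "(\<lambda>s. t s * (?h s * f s)) \<in> W"
        by (rule Wcong) (simp add: eq[OF _ i, symmetric] algebra_simps)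
    qed
    then have "fun_vs.span ?T \<subseteq> {f. (\<lambda>s. t s * f s) \<in> W}"
      using sub by (rule fun_vs.span_minimal)
    moreover have "?R \<subseteq> fun_vs.span ?T"
      by (intro fun_vs.span_minimal stair_monomials_1_subset_span I fun_vs.subspace_span)
    ultimately show ?thesis using that by blast
  qed
  have stable: "(\<lambda>s. t s * f s) \<in> W" if "f \<in> W" for f
  proof -
    from that obtain g where g: "g \<in> ?R" "\<forall>s\<in>S. f s = g s" unfolding W_def by auto
    from stable_R[OF g(1)] show ?thesis by (rule Wcong) (simp add: g(2))
  qed
  have powers: "(\<lambda>s. 1 * t s ^ k) \<in> W" for k
  proof (induction k)
    case 0
    show ?case using RW fun_vs.span_base[OF one_in_stair_monomials] by auto
  next
    case (Suc k)
    show ?case using stable[OF Suc.IH] by simp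
  qed
  have polys: "(\<lambda>s. poly p (t s)) \<in> W" for p
    using poly_comp_in_subspace[OF W powers, of p] by simp
  \<comment> \<open>Indicators of points of \<open>S\<close> are Lagrange polynomials in
    \<open>t\<close>. Representatives are taken in \<open>?R\<close>, where the number of monomials
    bounds the size of an independent set.\<close>
  have "\<exists>g\<in>?R. \<forall>s'\<in>S. g s' = (if s' = s then 1 else 0)" if s: "s \<in> S" for s
  proof -
    let ?d = "\<Prod>r\<in>S - {s}. t s - t r"
    let ?p = "smult (inverse ?d) (\<Prod>r\<in>S - {s}. [:- t r, 1:])"
    have "?d \<noteq> 0" using assms(1,2) s by (auto simp: inj_on_def)
    moreover have "(\<Prod>r\<in>S - {s}. t s' - t r) = 0" if "s' \<in> S" "s' \<noteq> s" for s'
      using that assms(1) by (intro prod_zero) auto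
    ultimately have "\<forall>s'\<in>S. poly ?p (t s') = (if s' = s then 1 else 0)"
      by (auto simp: poly_prod)
    moreover obtain g where "g \<in> ?R" "\<forall>s'\<in>S. poly ?p (t s') = g s'"
      using polys[of ?p] unfolding W_def by blast
    ultimately show ?thesis by (intro bexI[of _ g]) auto
  qed
  then obtain \<delta> where \<delta>: "\<And>s. s \<in> S \<Longrightarrow> \<delta> s \<in> ?R"
    "\<And>s s'. s \<in> S \<Longrightarrow> s' \<in> S \<Longrightarrow> \<delta> s s' = (if s' = s then 1 else 0)"
    by metis
  have inj: "inj_on \<delta> S"
    using \<delta>(2) by (intro inj_onI) (metis zero_neq_one)
  have "fun_vs.independent (\<delta> ` S)"
  proof -
    have "u (\<delta> s) = 0" if u: "(\<Sum>v\<in>\<delta> ` S. (\<lambda>s. u v * v s)) = 0" and s: "s \<in> S" for u s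
    proof -
      have "0 = (\<Sum>v\<in>\<delta> ` S. (\<lambda>s. u v * v s)) s" using u by simp
      also have "\<dots> = (\<Sum>s'\<in>S. u (\<delta> s') * \<delta> s' s)"
        by (simp add: sum_fun_apply sum.reindex[OF inj])
      also have "\<dots> = (\<Sum>s'\<in>S. if s' = s then u (\<delta> s') else 0)"
        using s by (intro sum.cong) (auto simp: \<delta>(2))
      also have "\<dots> = u (\<delta> s)" using s assms(1) by simp
      finally show ?thesis by simp
    qed
    then show ?thesis using assms(1) by (auto simp: fun_vs.dependent_finite)
  qed
  then have "card (\<delta> ` S) \<le> card (stair_monomials x 1 n)"
    using fun_vs.independent_span_bound[OF finite_stair_monomials] \<delta>(1) by blast
  then show ?thesis
    using card_stair_monomials_1[of x n] by (simp add: card_image[OF inj])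
qed

section \<open>Frobenius powers and subgroups of finite fields\<close>

lemma power_frobenius_diff:
  fixes y z :: "'a::{field, finite}"
  assumes "prime_power q" and "card (UNIV :: 'a set) = q ^ m"
  shows "(y - z) ^ (q ^ j) = y ^ (q ^ j) - z ^ (q ^ j)"
proof -
  obtain p k where p: "prime p" "q = p ^ k"
    using assms(1) unfolding prime_power_def by auto
  \<comment> \<open>Translation by 1 permutes the field, so the field's cardinality vanishes in it.
    Hence the characteristic divides a power of \<open>p\<close>, and being prime it is
    \<open>p\<close>.\<close>
  have "(\<Sum>x\<in>(UNIV :: 'a set). x + 1) = (\<Sum>x\<in>UNIV. x)"
    by (rule sum.reindex_bij_witness[of _ "\<lambda>x. x - 1" "\<lambda>x. x + 1"]) auto
  then have "of_nat (card (UNIV :: 'a set)) = (0 :: 'a)"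
    by (simp add: sum.distrib)
  then have "CHAR('a) dvd p ^ (k * m)"
    unfolding of_nat_eq_0_iff_char_dvd assms(2) p(2) power_mult .
  moreover have prime: "prime CHAR('a)"
    by (intro prime_CHAR_semidom finite_imp_CHAR_pos) auto
  ultimately have char: "p = CHAR('a)"
    using p(1) prime_dvd_power primes_dvd_imp_eq by metis
  have "(y - z + z) ^ (q ^ j) = (y - z) ^ (q ^ j) + z ^ (q ^ j)"
    by (rule freshmans_dream'[OF prime, of _ "k * j"]) (simp add: p(2) char power_mult)
  then show ?thesis by (simp add: algebra_simps)
qed

text \<open>Multiplication by \<open>h\<close> permutes \<open>H\<close>, so comparing the products
  over \<open>H\<close> gives \<open>h ^ card H = 1\<close>; the polynomial has no room for further
  roots.\<close>

lemma mult_subgroup_eq_roots_of_unity: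
  fixes H :: "'a::{field, finite} set"
  assumes "mult_subgroup H"
  shows "H = {z. z ^ card H = 1}"
proof (rule card_subset_eq)
  have pos: "card H > 0"
    using assms by (auto simp: mult_subgroup_def card_gt_0_iff)
  show sub: "H \<subseteq> {z. z ^ card H = 1}"
  proof
    fix h assume h: "h \<in> H"
    then have "h \<noteq> 0" using assms by (auto simp: mult_subgroup_def)
    have "(\<Prod>x\<in>H. h * x) = (\<Prod>x\<in>H. x)"
      by (rule prod.reindex_bij_witness[of _ "\<lambda>x. inverse h * x" "\<lambda>x. h * x"])
        (use assms h \<open>h \<noteq> 0\<close> in \<open>auto simp: mult_subgroup_def simp flip: mult.assoc\<close>)
    then have "h ^ card H * (\<Prod>x\<in>H. x) = (\<Prod>x\<in>H. x)"
      by (simp add: prod.distrib)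
    moreover have "(\<Prod>x\<in>H. x) \<noteq> 0"
      using assms by (auto simp: mult_subgroup_def)
    ultimately show "h \<in> {z. z ^ card H = 1}" by simp
  qed
  let ?p = "monom 1 (card H) - 1 :: 'a poly"
  have "coeff ?p (card H) = 1" using pos by (auto simp: card_gt_0_iff)
  then have nz: "?p \<noteq> 0" by (metis coeff_0 zero_neq_one)
  have "card {z. poly ?p z = 0} \<le> degree ?p"
    using nz by (intro card_poly_roots_bound) auto
  also have "\<dots> \<le> card H"
    by (intro degree_diff_le) (auto simp: degree_monom_le)
  finally have "card {z::'a. z ^ card H = 1} \<le> card H"
    by (simp add: poly_monom)
  then show "card H = card {z::'a. z ^ card H = 1}"
    using card_mono[OF _ sub] by simp
qed simp

section \<open>Vertices as orbits and adjacency on representatives\<close>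

lemma G_vertex_memD:
  assumes "mult_subgroup H" and "X \<in> G_vertices H" and "(a, b) \<in> X"
  shows "(a, b) \<noteq> (0, 0)" and "X = {(h * a, h * b) | h. h \<in> H}"
proof -
  have H: "h \<noteq> 0" "inverse h \<in> H" "h * k \<in> H" if "h \<in> H" "k \<in> H" for h k
    using that assms(1) by (auto simp: mult_subgroup_def)
  obtain c d where cd: "(c, d) \<noteq> (0, 0)" "X = scal_rel H `` {(c, d)}"
    using assms(2) by (auto simp: G_vertices_def quotient_def)
  then obtain h where h: "h \<in> H" "c = h * a" "d = h * b" "(a, b) \<noteq> (0, 0)"
    using assms(3) by (auto simp: scal_rel_def)
  have "X = {(g * a, g * b) | g. g \<in> H}"
  proof (intro set_eqI iffI)
    fix v assume "v \<in> X"
    then obtain g where g: "g \<in> H" "c = g * fst v" "d = g * snd v"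
      using cd by (cases v) (auto simp: scal_rel_def)
    then have "v = ((inverse g * h) * a, (inverse g * h) * b)"
      using H(1)[OF g(1) g(1)] h by (cases v) (auto simp: field_simps)
    moreover have "inverse g * h \<in> H"
      using H(2,3) g(1) h(1) by blast
    ultimately show "v \<in> {(g * a, g * b) | g. g \<in> H}" by blast
  next
    fix v assume "v \<in> {(g * a, g * b) | g. g \<in> H}"
    then obtain g where g: "g \<in> H" "v = (g * a, g * b)" by blast
    have "h * inverse g \<in> H" using H(2,3) g(1) h(1) by blast
    moreover have "c = (h * inverse g) * (g * a)" "d = (h * inverse g) * (g * b)"
      using h H(1)[OF g(1) g(1)] by simp_all
    ultimately show "v \<in> X"
      using cd h(4) H(1)[OF g(1) g(1)] g(2) by (auto simp: scal_rel_def)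
  qed
  then show "(a, b) \<noteq> (0, 0)" "X = {(h * a, h * b) | h. h \<in> H}" using h by auto
qed

lemma G_adj_representatives:
  assumes "mult_subgroup H" and "X \<in> G_vertices H" and "Y \<in> G_vertices H"
    and "G_adj H X Y" and "(a, b) \<in> X" and "(x, y) \<in> Y"
  shows "a * x + b * y \<in> H"
proof -
  obtain a' b' x' y' where *: "(a', b') \<in> X" "(x', y') \<in> Y" "a' * x' + b' * y' \<in> H"
    using assms(4) by (auto simp: G_adj_def)
  obtain g where g: "g \<in> H" "a = g * a'" "b = g * b'"
    using G_vertex_memD(2)[OF assms(1,2) *(1)] assms(5) by auto
  obtain h where h: "h \<in> H" "x = h * x'" "y = h * y'"
    using G_vertex_memD(2)[OF assms(1,3) *(2)] assms(6) by auto
  have "a * x + b * y = (g * h) * (a' * x' + b' * y')"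
    using g h by (simp add: algebra_simps)
  then show ?thesis
    using g(1) h(1) *(3) assms(1) by (simp add: mult_subgroup_def)
qed

lemma G_vertex_eqI:
  assumes "mult_subgroup H" and "X \<in> G_vertices H" and "Y \<in> G_vertices H"
    and "(a, b) \<in> X" and "(c, d) \<in> Y" and "h \<in> H" and "c = h * a" and "d = h * b"
  shows "X = Y"
proof -
  have "(c, d) \<in> X" using G_vertex_memD(2)[OF assms(1,2,4)] assms by blast
  then show ?thesis
    using G_vertex_memD(2)[OF assms(1,2), of c d] G_vertex_memD(2)[OF assms(1,3,5)] by simp
qed

text \<open>If the representatives were proportional, the factor would be the quotient of the two
  values at \<open>(x, y)\<close>. That quotient lies in \<open>H\<close>, so the classes would
  coincide.\<close>

lemma G_common_neighbour_imp_independent: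
  assumes "mult_subgroup H" and "X \<in> G_vertices H" and "X' \<in> G_vertices H"
    and "(a, b) \<in> X" and "(a', b') \<in> X'" and "X \<noteq> X'"
    and "a * x + b * y \<in> H" and "a' * x + b' * y \<in> H"
  shows "a * b' - a' * b \<noteq> 0"
proof
  let ?u = "a * x + b * y" and ?u' = "a' * x + b' * y"
  assume 0: "a * b' - a' * b = 0"
  have nz: "?u \<noteq> 0" using assms(1,7) by (auto simp: mult_subgroup_def)
  define w where "w = inverse ?u"
  have w: "w * ?u = 1" using nz by (simp add: w_def)
  have "?u' * w \<in> H"
    using assms(1,7,8) by (simp add: mult_subgroup_def w_def)
  moreover have "a' = ?u' * w * a" "b' = ?u' * w * b"
    using 0 w by algebra+
  ultimately have "X = X'" by (rule G_vertex_eqI[OF assms(1-5)])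
  then show False using assms(6) by simp
qed

section \<open>From common neighbours to a product system\<close>

theorem theorem7:
  fixes q r :: nat and H :: "'a::{field, finite} set"
  assumes "prime_power q" and "r \<ge> 2"
    and "card (UNIV :: 'a set) = q ^ (r - 1)"
    and "mult_subgroup H"
    and "card H = (\<Sum>i<r - 1. q ^ i)"
  shows "Ksu_free (G_vertices H) (G_adj H) r (fact (r - 1) + 1)"
  unfolding Ksu_free_def
proof (intro notI, elim exE conjE)
  fix S T
  assume S: "S \<subseteq> G_vertices H" "finite S" "card S = r"
    and T: "T \<subseteq> G_vertices H" "finite T" "card T = fact (r - 1) + 1"
    and adj: "\<forall>X\<in>S. \<forall>Y\<in>T. G_adj H X Y"
  have r_eq: "r - 1 = Suc (r - 2)" using assms(2) by simp
  have H: "h \<noteq> 0" "inverse h \<in> H" "h * k \<in> H" if "h \<in> H" "k \<in> H" for h k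
    using that assms(4) by (auto simp: mult_subgroup_def)
  have "\<exists>a b. (a, b) \<in> X" if "X \<in> G_vertices H" for X
    using that assms(4)
    by (fastforce simp: G_vertices_def quotient_def scal_rel_def mult_subgroup_def)
  then obtain a b where ab: "\<And>X. X \<in> G_vertices H \<Longrightarrow> (a X, b X) \<in> X"
    by metis
  have inH: "a X * a Y + b X * b Y \<in> H" if "X \<in> S" "Y \<in> T" for X Y
    using that S(1) T(1) adj ab assms(4) by (intro G_adj_representatives[of H X Y]) auto
  \<comment> \<open>One common neighbour is enough to make the vertices in \<open>S\<close> pairwise
    independent.\<close>
  obtain Y0 where Y0: "Y0 \<in> T" using T(3) by fastforce
  define D where "D X X' = a X * b X' - a X' * b X" for X X'
  have D: "D X X' \<noteq> 0" if "X \<in> S" "X' \<in> S" "X \<noteq> X'" for X X'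
    unfolding D_def using that S(1) ab inH[OF _ Y0] assms(4)
    by (intro G_common_neighbour_imp_independent[of H X X']) auto
  obtain X0 where X0: "X0 \<in> S" using S(3) assms(2) by fastforce
  define I where "I = S - {X0}"
  have I: "finite I" "card I = Suc (r - 2)"
    using S X0 assms(2) by (auto simp: I_def)
  \<comment> \<open>The pair \<open>(c, d)\<close> completes the representative of \<open>X0\<close>
    to a basis, so the forms \<open>u\<close> and \<open>v\<close> below are coordinates.\<close>
  obtain c d where \<Delta>: "a X0 * d - b X0 * c \<noteq> 0"
  proof (cases "a X0 = 0")
    case True
    then have "b X0 \<noteq> 0" using G_vertex_memD(1)[OF assms(4) _ ab] X0 S(1) by auto
    then show ?thesis using that[of 0 1] True by simp
  next
    case False
    then show ?thesis using that[of 1 0] by simp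
  qed
  define \<Delta> where "\<Delta> = a X0 * d - b X0 * c"
  define u where "u Y = a X0 * a Y + b X0 * b Y" for Y
  define v where "v Y = c * a Y + d * b Y" for Y
  define t where "t Y = v Y / u Y" for Y
  \<comment> \<open>\<open>e X\<close> is the value of \<open>v / u\<close> at which the linear form
    of \<open>X\<close> vanishes; hence that form divided by \<open>u\<close> is a constant multiple
    of \<open>t - e X\<close>.\<close>
  define e where "e X = - ((a X * d - b X * c) / D X0 X)" for X
  have u: "u Y \<in> H" "u Y \<noteq> 0" if "Y \<in> T" for Y
    using inH[OF X0 that] H(1) by (auto simp: u_def)
  have inj_t: "inj_on t T"
  proof (rule inj_onI)
    fix Y Y' assume Y: "Y \<in> T" "Y' \<in> T" and "t Y = t Y'"
    \<comment> \<open>Equal ratios make both coordinates of \<open>Y'\<close> the same multiple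
      \<open>?h\<close> of those of \<open>Y\<close>; Cramer's rule carries this back to the
      representatives.\<close>
    let ?h = "u Y' * inverse (u Y)"
    have uv: "u Y' = ?h * u Y" "v Y' = ?h * v Y"
      using u[OF Y(1)] u[OF Y(2)] \<open>t Y = t Y'\<close> by (simp_all add: t_def field_simps)
    have co: "\<Delta> * a Z = d * u Z - b X0 * v Z" "\<Delta> * b Z = a X0 * v Z - c * u Z" for Z
      by (simp_all add: \<Delta>_def u_def v_def algebra_simps)
    have "\<Delta> * a Y' = \<Delta> * (?h * a Y)" "\<Delta> * b Y' = \<Delta> * (?h * b Y)"
      using uv co[of Y'] co[of Y] by algebra+
    then have "a Y' = ?h * a Y" "b Y' = ?h * b Y"
      using \<Delta> by (simp_all add: \<Delta>_def)
    moreover have "?h \<in> H" using u(1)[OF Y(1)] u(1)[OF Y(2)] H(2,3) by blast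
    ultimately show "Y = Y'"
      using G_vertex_eqI[OF assms(4) _ _ ab ab] Y T(1) by blast
  qed
  have inj_e: "inj_on e I"
  proof (rule inj_onI)
    fix X X' assume X: "X \<in> I" "X' \<in> I" and eq: "e X = e X'"
    have nz: "D X0 X \<noteq> 0" "D X0 X' \<noteq> 0" using D X0 X by (auto simp: I_def)
    have "(a X * d - b X * c) * D X0 X' = (a X' * d - b X' * c) * D X0 X"
      using eq nz by (simp add: e_def field_simps)
    \<comment> \<open>The three-term Pluecker relation for \<open>X0\<close>, \<open>X\<close>,
      \<open>X'\<close> and \<open>(c, d)\<close>.\<close>
    then have "\<Delta> * D X X' = 0" unfolding D_def \<Delta>_def by algebra
    then have "D X X' = 0" using \<Delta> by (simp add: \<Delta>_def)
    then show "X = X'" using D X by (auto simp: I_def)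
  qed
  have diff: "t Y - e X = (\<Delta> / D X0 X) * ((a X * a Y + b X * b Y) * inverse (u Y))"
    if "Y \<in> T" "X \<in> I" for X Y
  proof -
    have nz: "D X0 X \<noteq> 0" using D X0 that by (auto simp: I_def)
    have "v Y * D X0 X + (a X * d - b X * c) * u Y = \<Delta> * (a X * a Y + b X * b Y)"
      unfolding D_def \<Delta>_def u_def v_def by algebra
    then show ?thesis
      using nz u(2)[OF that(1)] by (simp add: t_def e_def field_simps)
  qed
  have "card T \<le> fact (Suc (r - 2))"
  \<comment> \<open>Variable \<open>k\<close> is the power \<open>q ^ Suc k\<close> of
    \<open>t\<close>: the exponent \<open>q ^ 0\<close> is left for the separate factor
    \<open>t Y - e X\<close>.\<close>
  proof (rule card_product_system_le_fact[OF T(2) inj_t I])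
    show "inj_on (\<lambda>X. e X ^ (q ^ Suc k)) I" for k
    proof (rule inj_onI)
      fix X X' assume "X \<in> I" "X' \<in> I" "e X ^ (q ^ Suc k) = e X' ^ (q ^ Suc k)"
      then have "(e X - e X') ^ (q ^ Suc k) = 0"
        unfolding power_frobenius_diff[OF assms(1,3)] by simp
      then show "X = X'" using inj_e \<open>X \<in> I\<close> \<open>X' \<in> I\<close> by (simp add: inj_on_def)
    qed
  next
    fix Y X assume Y: "Y \<in> T" and X: "X \<in> I"
    have M: "card H = (\<Sum>i<Suc (r - 2). q ^ i)"
      using assms(5) unfolding r_eq .
    have "(a X * a Y + b X * b Y) * inverse (u Y) \<in> H"
      using inH[OF _ Y] u(1)[OF Y] X H(2,3) by (auto simp: I_def)
    then have w: "((a X * a Y + b X * b Y) * inverse (u Y)) ^ card H = 1"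
      using mult_subgroup_eq_roots_of_unity[OF assms(4)] by blast
    have "(t Y - e X) * (\<Prod>k<r - 2. t Y ^ (q ^ Suc k) - e X ^ (q ^ Suc k))
        = (\<Prod>k<Suc (r - 2). (t Y - e X) ^ (q ^ k))"
      by (subst prod.lessThan_Suc_shift)
        (simp add: power_frobenius_diff[OF assms(1,3)] del: power_Suc)
    \<comment> \<open>The Frobenius exponents add up to \<open>card H\<close>, giving the norm. The
      factor of \<open>t Y - e X\<close> lying in \<open>H\<close> has norm 1, so the value is
      independent of \<open>Y\<close>.\<close>
    also have "\<dots> = (t Y - e X) ^ card H"
      by (simp only: M power_sum)
    also have "\<dots> = (\<Delta> / D X0 X) ^ card H"
      unfolding diff[OF Y X] power_mult_distrib[of "\<Delta> / D X0 X"] w by simp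
    finally show "(t Y - e X) * (\<Prod>k<r - 2. t Y ^ (q ^ Suc k) - e X ^ (q ^ Suc k))
        = (\<Delta> / D X0 X) ^ card H" .
  qed
  then show False
    using T(3) unfolding r_eq by simp
qed

end
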